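(* There exist an absolute constant $c>0$ and $n_0\in\mathbb{N}$ such that for every integer $n\geq n_0$ and every integer $k$ with $1\leq k\leq\log n$, there exists a set $X\subseteq\mathbb{R}^2$ with $|X|=n$ such that \[a_k(X)-a_{k+1}(X)\geq c\,\frac{n}{k}\log n .\] Moreover, the distances with the $k$ largest multiplicities can be prescribed: for any pairwise distinct reals $d_1,\dots,d_k>0$, such an $X$ can be chosen so that the distances having the $k$ largest multiplicities in $X$ are exactly $d_1,\dots,d_k$.
   Context: For a finite set $X\subseteq\mathbb{R}^2$ determining $m$ distinct Euclidean distances between its points, the multiplicity of a distance is the number of unordered pairs of distinct points of $X$ at that distance, and $a_1(X)\geq a_2(X)\geq\cdots\geq a_m(X)$ denote the multiplicities of the $m$ distances in non-increasing order (irrespective of the sizes of the distances). Here $\log$ is the logarithm to base $2$. *)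

theory Defs
  imports "HOL-Analysis.Analysis" "HOL-Library.Multiset"
begin

definition distances :: "(real ^ 2) set \<Rightarrow> real set" where
  "distances X = {dist x y | x y. x \<in> X \<and> y \<in> X \<and> x \<noteq> y}"

definition multiplicity_at :: "(real ^ 2) set \<Rightarrow> real \<Rightarrow> nat" where
  "multiplicity_at X \<delta> = card {{x, y} | x y. x \<in> X \<and> y \<in> X \<and> x \<noteq> y \<and> dist x y = \<delta>}"

definition multiplicities :: "(real ^ 2) set \<Rightarrow> nat list" where
  "multiplicities X =
     rev (sorted_list_of_multiset (image_mset (multiplicity_at X) (mset_set (distances X))))"

(* Indices start at 1; the value is meaningful for finite X and 1 \<le> i \<le> card (distances X). *)
definition ranked_multiplicity :: "nat \<Rightarrow> (real ^ 2) set \<Rightarrow> nat" where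
  "ranked_multiplicity i X = multiplicities X ! (i - 1)"

(* Contains all distances tied with the k-th one, so it has exactly k elements precisely when
   the k-th and (k+1)-st multiplicities differ (or there is no (k+1)-st one). *)
definition top_distances :: "nat \<Rightarrow> (real ^ 2) set \<Rightarrow> real set" where
  "top_distances k X = {\<delta> \<in> distances X. multiplicity_at X \<delta> \<ge> ranked_multiplicity k X}"

end

theory Submission
  imports Defs
begin

text \<open>
  Let \<open>L = \<lfloor>log n\<rfloor>\<close> and take the \<open>2 ^ L\<close> subset sums of \<open>L\<close> generic plane vectors, about
  \<open>L / k\<close> of which have length \<open>d\<^sub>i\<close> for each \<open>i\<close>. Every vector of length \<open>d\<^sub>i\<close> contributes
  \<open>2 ^ (L - 1)\<close> pairs at distance \<open>d\<^sub>i\<close>, while any other difference of two points is, up to sign,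
  the only one of its length and involves at least two of the vectors, hence occurs at most
  \<open>2 ^ (L - 2)\<close> times. The remaining \<open>n - 2 ^ L < 2 ^ L\<close> points are put in general position, so that
  the distances they create have multiplicity one. All genericity conditions on a vector of given
  length exclude finitely many lines and points, hence finitely many points of a circle.
\<close>

section \<open>Generic vectors of prescribed length\<close>

lemma infinite_circle:
  assumes "r > 0"
  shows "infinite {u :: real^2. norm u = r}"
proof
  assume fin: "finite {u :: real^2. norm u = r}"
  have "{-r..r} \<subseteq> (\<lambda>u. u $ 1) ` {u :: real^2. norm u = r}"
  proof
    fix t assume t: "t \<in> {-r..r}"
    have "t\<^sup>2 \<le> r\<^sup>2" using t assms by (auto intro: power2_le_iff_abs_le[THEN iffD2])
    then have "norm (vector [t, sqrt (r\<^sup>2 - t\<^sup>2)] :: real^2) = r"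
      using assms by (simp add: norm_eq_sqrt_inner inner_vec_def sum_2 flip: power2_eq_square)
    then show "t \<in> (\<lambda>u. u $ 1) ` {u :: real^2. norm u = r}"
      by (auto intro!: image_eqI[where x = "vector [t, sqrt (r\<^sup>2 - t\<^sup>2)]"])
  qed
  then have "finite {-r..r}" using fin finite_surj by blast
  then show False using assms infinite_Icc[of "- r" r] by simp
qed

text \<open>Eliminating one coordinate between line and circle leaves a quadratic for the other,
  with leading coefficient the squared norm of \<open>a\<close>, which is nonzero.\<close>

lemma finite_circle_Int_line:
  fixes a :: "real^2"
  assumes "a \<noteq> 0"
  shows "finite {u. norm u = r \<and> a \<bullet> u = b}"
proof -
  \<comment> \<open>\<open>p\<close> expands \<open>(a$2)\<^sup>2 * (r\<^sup>2 - x\<^sup>2) = (b -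
    a$1 * x)\<^sup>2\<close>; \<open>q\<close> is the same with the coordinates exchanged.\<close>
  define p where "p = [:b\<^sup>2 - (a$2)\<^sup>2 * r\<^sup>2, - 2 * b * a$1, (a$1)\<^sup>2 + (a$2)\<^sup>2:]"
  define q where "q = [:b\<^sup>2 - (a$1)\<^sup>2 * r\<^sup>2, - 2 * b * a$2, (a$1)\<^sup>2 + (a$2)\<^sup>2:]"
  have "(a$1)\<^sup>2 + (a$2)\<^sup>2 \<noteq> 0"
    using assms by (simp add: sum_power2_eq_zero_iff vec_eq_iff forall_2)
  then have fin: "finite {x. poly p x = 0}" "finite {x. poly q x = 0}"
    by (intro poly_roots_finite; simp add: p_def q_def)+
  have "{u. norm u = r \<and> a \<bullet> u = b} \<subseteq>
      (\<lambda>(x,y). vector [x,y]) ` ({x. poly p x = 0} \<times> {x. poly q x = 0})"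
  proof safe
    fix u :: "real^2" assume "r = norm u" "b = a \<bullet> u"
    then have r: "r\<^sup>2 = (u$1)\<^sup>2 + (u$2)\<^sup>2" and b: "b = a$1 * u$1 + a$2 * u$2"
      by (simp_all add: power2_norm_eq_inner inner_vec_def sum_2 flip: power2_eq_square)
    have "poly p (u$1) = 0" "poly q (u$2) = 0"
      unfolding p_def q_def r b by (simp_all add: algebra_simps power2_eq_square)
    moreover have "u = vector [u$1, u$2]" by (simp add: vec_eq_iff forall_2)
    ultimately show "u \<in> (\<lambda>(x,y). vector [x,y]) ` ({x. poly p x = 0} \<times> {x. poly q x = 0})"
      by (auto intro!: image_eqI[where x = "(u$1, u$2)"])
  qed
  then show ?thesis by (rule finite_subset) (use fin in simp)
qed

text \<open>On the circle of radius \<open>r\<close>, the squared norm of \<open>v + u\<close> is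
  affine in \<open>u\<close>. So a prescribed value of \<open>norm (v + u)\<close>, or a coincidence
  of two such norms, confines \<open>u\<close> to a line with normal \<open>v\<close> or
  \<open>v - w\<close>. These normals are nonzero, so each line removes finitely many points of an
  infinite circle.\<close>

lemma generic_vector_of_norm:
  fixes V B :: "(real^2) set" and F :: "real set"
  assumes "r > 0" "finite V" "0 \<notin> V" "finite F" "finite B"
  obtains u where "norm u = r" "u \<notin> B" "\<And>v. v \<in> V \<Longrightarrow> norm (v + u) \<notin> F"
    "inj_on (\<lambda>v. norm (v + u)) V"
proof -
  have sq: "(norm (v + u))\<^sup>2 = (norm v)\<^sup>2 + r\<^sup>2 + 2 * (v \<bullet> u)" if "norm u = r" for u v :: "real^2"
    using that by (simp add: power2_norm_eq_inner inner_add inner_commute flip: that)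
  define bad where "bad = B
    \<union> (\<Union>(v,f)\<in>V \<times> F. {u. norm u = r \<and> v \<bullet> u = (f\<^sup>2 - (norm v)\<^sup>2 - r\<^sup>2) / 2})
    \<union> (\<Union>(v,w)\<in>{(v,w). v \<in> V \<and> w \<in> V \<and> v \<noteq> w}.
          {u. norm u = r \<and> (v - w) \<bullet> u = ((norm w)\<^sup>2 - (norm v)\<^sup>2) / 2})"
  have "finite {(v,w). v \<in> V \<and> w \<in> V \<and> v \<noteq> w}"
    by (rule finite_subset[of _ "V \<times> V"]) (use assms in auto)
  then have "finite bad" unfolding bad_def
    using assms
    by (auto intro!: finite_circle_Int_line finite_UN_I simp del: eq_divide_eq_numeral1 inner_diff_left)
  then have "infinite ({u :: real^2. norm u = r} - bad)"
    using infinite_circle[OF \<open>r > 0\<close>] by (simp add: Diff_infinite_finite)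
  then obtain u where u: "norm u = r" "u \<notin> bad"
    using infinite_imp_nonempty by blast
  show thesis
  proof
    show "norm u = r" "u \<notin> B" using u by (auto simp: bad_def)
    show "norm (v + u) \<notin> F" if "v \<in> V" for v
    proof
      assume "norm (v + u) \<in> F"
      moreover have "v \<bullet> u = ((norm (v + u))\<^sup>2 - (norm v)\<^sup>2 - r\<^sup>2) / 2"
        using sq[OF u(1), of v] by simp
      ultimately show False using u that by (auto simp: bad_def)
    qed
    show "inj_on (\<lambda>v. norm (v + u)) V"
    proof (rule inj_onI, rule ccontr)
      fix v w assume vw: "v \<in> V" "w \<in> V" "norm (v + u) = norm (w + u)" "v \<noteq> w"
      have "(v - w) \<bullet> u = ((norm w)\<^sup>2 - (norm v)\<^sup>2) / 2"
        using sq[OF u(1), of v] sq[OF u(1), of w] vw(3) by (simp add: inner_diff_left)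
      then show False using u vw by (auto simp: bad_def)
    qed
  qed
qed

section \<open>Counting differences\<close>

text \<open>Ordered pairs and an arbitrary predicate let one notion count both difference vectors
  and lengths, and turn a translation of a set into a substitution in the predicate.\<close>

definition diff_count :: "'a::ab_group_add set \<Rightarrow> 'a set \<Rightarrow> ('a \<Rightarrow> bool) \<Rightarrow> nat" where
  "diff_count A B P = card {(x, y). x \<in> A \<and> y \<in> B \<and> P (y - x)}"

lemma finite_diff_pairs:
  "finite A \<Longrightarrow> finite B \<Longrightarrow> finite {(x, y). x \<in> A \<and> y \<in> B \<and> P (y - x)}"
  by (rule finite_subset[of _ "A \<times> B"]) auto

lemma diff_count_Un_left:
  assumes "finite A" "finite A'" "finite B" "A \<inter> A' = {}"
  shows "diff_count (A \<union> A') B P = diff_count A B P + diff_count A' B P"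
proof -
  have "{(x, y). x \<in> A \<union> A' \<and> y \<in> B \<and> P (y - x)} =
      {(x, y). x \<in> A \<and> y \<in> B \<and> P (y - x)} \<union> {(x, y). x \<in> A' \<and> y \<in> B \<and> P (y - x)}"
    by auto
  then show ?thesis unfolding diff_count_def
    using assms by (auto intro!: card_Un_disjoint finite_diff_pairs)
qed

lemma diff_count_swap: "diff_count A B P = diff_count B A (\<lambda>v. P (- v))"
proof -
  have "bij_betw prod.swap {(x, y). x \<in> A \<and> y \<in> B \<and> P (y - x)}
      {(x, y). x \<in> B \<and> y \<in> A \<and> P (- (y - x))}"
    by (rule bij_betw_byWitness[where f' = prod.swap]) auto
  then show ?thesis unfolding diff_count_def by (rule bij_betw_same_card)
qed

lemma diff_count_Un_right:
  assumes "finite A" "finite B" "finite B'" "B \<inter> B' = {}"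
  shows "diff_count A (B \<union> B') P = diff_count A B P + diff_count A B' P"
  using assms by (simp add: diff_count_swap[of A] diff_count_Un_left)

lemma diff_count_translate_left:
  "diff_count ((+) u ` A) B P = diff_count A B (\<lambda>v. P (v - u))"
proof -
  have "bij_betw (\<lambda>(x, y). (u + x, y)) {(x, y). x \<in> A \<and> y \<in> B \<and> P (y - x - u)}
      {(x, y). x \<in> (+) u ` A \<and> y \<in> B \<and> P (y - x)}"
    by (rule bij_betw_byWitness[where f' = "\<lambda>(x, y). (x - u, y)"]) (auto simp: algebra_simps)
  then show ?thesis unfolding diff_count_def by (rule bij_betw_same_card[symmetric])
qed

lemma diff_count_translate_right:
  "diff_count A ((+) u ` B) P = diff_count A B (\<lambda>v. P (v + u))"
  by (simp add: diff_count_swap[of A] diff_count_translate_left)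

lemma diff_count_mono:
  assumes "finite A" "finite B"
    and "\<And>x y. x \<in> A \<Longrightarrow> y \<in> B \<Longrightarrow> P (y - x) \<Longrightarrow> Q (y - x)"
  shows "diff_count A B P \<le> diff_count A B Q"
  unfolding diff_count_def using assms by (auto intro!: card_mono finite_diff_pairs)

lemma diff_count_eq_0:
  assumes "\<And>x y. x \<in> A \<Longrightarrow> y \<in> B \<Longrightarrow> \<not> P (y - x)"
  shows "diff_count A B P = 0"
  unfolding diff_count_def using assms by (auto simp: card_eq_0_iff)

lemma diff_count_zero: "diff_count A A (\<lambda>v. v = 0) = card A"
proof -
  have "{(x, y). x \<in> A \<and> y \<in> A \<and> y - x = 0} = (\<lambda>x. (x, x)) ` A" by auto
  then show ?thesis unfolding diff_count_def by (simp add: card_image inj_on_def)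
qed

text \<open>Of the four blocks of pairs, the two inside one copy have the differences of
  \<open>X\<close>, and the two mixed blocks have these shifted by \<open>u\<close> in either
  direction.\<close>

lemma diff_count_Un_translate:
  fixes X :: "'a::ab_group_add set"
  assumes "finite X" "X \<inter> (+) u ` X = {}"
  shows "diff_count (X \<union> (+) u ` X) (X \<union> (+) u ` X) P =
    2 * diff_count X X P + diff_count X X (\<lambda>v. P (v + u)) + diff_count X X (\<lambda>v. P (v - u))"
  using assms
  by (simp add: diff_count_Un_left diff_count_Un_right diff_count_translate_left
      diff_count_translate_right)

lemma diff_count_insert:
  assumes "finite X" "p \<notin> X"
  shows "diff_count (insert p X) (insert p X) P =
    diff_count X X P + diff_count {p} X P + diff_count {p} X (\<lambda>v. P (- v)) + diff_count {p} {p} P"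
proof -
  have "diff_count ({p} \<union> X) ({p} \<union> X) P =
      diff_count X X P + diff_count {p} X P + diff_count X {p} P + diff_count {p} {p} P"
    using assms by (simp add: diff_count_Un_left diff_count_Un_right del: Un_insert_left Un_insert_right)
  then show ?thesis by (simp add: diff_count_swap[of X "{p}"])
qed

text \<open>The map sending \<open>(x, y)\<close> to \<open>{x, y}\<close> is two-to-one here, since
  \<delta> > 0 excludes the diagonal.\<close>

lemma two_multiplicity_at:
  assumes "finite X" "\<delta> > 0"
  shows "2 * multiplicity_at X \<delta> = diff_count X X (\<lambda>v. norm v = \<delta>)"
proof -
  define E where "E = {{x, y} | x y. x \<in> X \<and> y \<in> X \<and> x \<noteq> y \<and> dist x y = \<delta>}"
  have "E \<subseteq> Pow X" by (auto simp: E_def)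
  then have finE: "finite E" using assms finite_subset by blast
  have pairs: "{(x, y). {x, y} = {a, b}} = {(a, b), (b, a)}" for a b :: "real^2"
    by (auto simp: doubleton_eq_iff)
  have c2: "card {(x, y). {x, y} = e} = 2 \<and> finite {(x, y). {x, y} = e}" if "e \<in> E" for e
    using that by (auto simp: E_def pairs)
  have "{(x, y). x \<in> X \<and> y \<in> X \<and> norm (y - x) = \<delta>} = (\<Union>e\<in>E. {(x, y). {x, y} = e})"
    using assms by (fastforce simp: E_def doubleton_eq_iff dist_norm norm_minus_commute)
  moreover have "card (\<Union>e\<in>E. {(x, y). {x, y} = e}) = (\<Sum>e\<in>E. card {(x, y). {x, y} = e})"
    using finE c2 by (intro card_UN_disjoint) auto
  ultimately show ?thesis
    using c2 by (simp add: diff_count_def multiplicity_at_def E_def[symmetric])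
qed

section \<open>The construction\<close>

text \<open>Each step of the induction joins to \<open>X\<close> its translate by a generic
  \<open>u\<close> of length \<open>e L\<close>. The bound on single vectors is what controls the
  lengths outside \<open>F\<close>: a newly created one stems from only one difference vector, up to
  sign. The counts are of ordered pairs, so the bound for such lengths means multiplicity at most a
  quarter of \<open>2 ^ L\<close>. The last clause later supplies a distance of rank
  \<open>k + 1\<close>.\<close>

lemma generic_hypercube:
  fixes e :: "nat \<Rightarrow> real" and F :: "real set"
  assumes "finite F" "\<And>j. e j > 0" "\<And>j. e j \<in> F"
  shows "\<exists>X :: (real^2) set. finite X \<and> card X = 2 ^ L
    \<and> (\<forall>v. v \<noteq> 0 \<longrightarrow> 2 * diff_count X X (\<lambda>w. w = v) \<le> 2 ^ L)
    \<and> (\<forall>\<delta>. \<delta> > 0 \<longrightarrow> \<delta> \<notin> F \<longrightarrow> 2 * diff_count X X (\<lambda>w. norm w = \<delta>) \<le> 2 ^ L)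
    \<and> (\<forall>\<delta>. card {j. j < L \<and> e j = \<delta>} * 2 ^ L \<le> diff_count X X (\<lambda>w. norm w = \<delta>))
    \<and> (L \<ge> 2 \<longrightarrow> (\<exists>x\<in>X. \<exists>y\<in>X. x \<noteq> y \<and> dist x y \<notin> F))"
proof (induction L)
  case 0
  have "diff_count {0} {0} P = 0" if "\<not> P 0" for P :: "real^2 \<Rightarrow> bool"
    using that by (intro diff_count_eq_0) simp
  then show ?case by (intro exI[of _ "{0}"]) auto
next
  case (Suc L)
  then obtain X :: "(real^2) set" where X: "finite X" "card X = 2 ^ L"
    and r: "\<And>v. v \<noteq> 0 \<Longrightarrow> 2 * diff_count X X (\<lambda>w. w = v) \<le> 2 ^ L"
    and off: "\<And>\<delta>. \<delta> > 0 \<Longrightarrow> \<delta> \<notin> F \<Longrightarrow> 2 * diff_count X X (\<lambda>w. norm w = \<delta>) \<le> 2 ^ L"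
    and on: "\<And>\<delta>. card {j. j < L \<and> e j = \<delta>} * 2 ^ L \<le> diff_count X X (\<lambda>w. norm w = \<delta>)"
    by blast
  define D where "D = (\<lambda>(x, y). y - x) ` (X \<times> X)"
  have D: "finite D" using X by (simp add: D_def)
  have DI: "y - x \<in> D" if "x \<in> X" "y \<in> X" for x y using that by (auto simp: D_def)
  \<comment> \<open>Avoiding \<open>F'\<close> keeps the lengths of mixed differences
    \<open>v + u\<close> with \<open>v\<close> nonzero away from the prescribed lengths and from
    those already present in \<open>X\<close>.\<close>
  define F' where "F' = F \<union> norm ` D"
  have F'I: "norm (y - x) \<in> F'" if "x \<in> X" "y \<in> X" for x y
    using DI[OF that] by (simp add: F'_def)
  \<comment> \<open>Excluding \<open>B\<close> means that neither \<open>u\<close> nor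
    \<open>u + u\<close> is a difference of two elements of \<open>D\<close>.\<close>
  define B where "B = (\<lambda>(v, w). v - w) ` (D \<times> D) \<union> (\<lambda>(v, w). (1/2) *\<^sub>R (v - w)) ` (D \<times> D)"
  obtain u where u: "norm u = e L" "u \<notin> B" "\<And>v. v \<in> D - {0} \<Longrightarrow> norm (v + u) \<notin> F'"
    "inj_on (\<lambda>v. norm (v + u)) (D - {0})"
    using generic_vector_of_norm[of "e L" "D - {0}" F' B] assms D
    by (auto simp: F'_def B_def)
  have uB: "v - w \<noteq> u" "v - w \<noteq> u + u" if "v \<in> D" "w \<in> D" for v w
  proof -
    show "v - w \<noteq> u" using u(2) that by (force simp: B_def)
    show "v - w \<noteq> u + u"
    proof
      assume "v - w = u + u"
      then have "u = (1/2) *\<^sub>R (v - w)" by (simp flip: scaleR_2)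
      then show False using u(2) that by (force simp: B_def)
    qed
  qed
  have "X \<noteq> {}" using X by auto
  then have "0 \<in> D" using DI by force
  have disj: "X \<inter> (+) u ` X = {}"
    using uB(1)[OF DI \<open>0 \<in> D\<close>] by (force simp: algebra_simps)
  define Y where "Y = X \<union> (+) u ` X"
  note split = diff_count_Un_translate[OF X(1) disj, folded Y_def]
  have sym: "diff_count X X (\<lambda>v. norm (v - u) = \<delta>) = diff_count X X (\<lambda>v. norm (v + u) = \<delta>)" for \<delta>
    by (subst diff_count_swap) (simp add: norm_minus_commute add.commute flip: norm_minus_cancel[of "_ - u"])
  have "finite Y" using X by (simp add: Y_def)
  moreover have "card Y = 2 ^ Suc L"
    using X disj by (simp add: Y_def card_Un_disjoint card_image)
  moreover have "2 * diff_count Y Y (\<lambda>w. w = v) \<le> 2 ^ Suc L" if "v \<noteq> 0" for v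
  proof -
    \<comment> \<open>Here \<open>z = 0\<close> must be allowed: it arises for \<open>v = u\<close>
      and \<open>v = - u\<close>, where the bound \<open>2 ^ L\<close> is attained.\<close>
    have triv: "diff_count X X (\<lambda>w. w = z) \<le> 2 ^ L" for z
      using diff_count_zero[of X] r[of z] X by (cases "z = 0") auto
    have none: "diff_count X X (\<lambda>w. w = z) = 0" if "z \<notin> D" for z
      using that DI by (intro diff_count_eq_0) auto
    have eq: "diff_count Y Y (\<lambda>w. w = v) = 2 * diff_count X X (\<lambda>w. w = v)
        + diff_count X X (\<lambda>w. w = v - u) + diff_count X X (\<lambda>w. w = v + u)"
      unfolding split by (simp add: eq_diff_eq diff_eq_eq)
    \<comment> \<open>By the choice of \<open>B\<close>, at most one of \<open>v\<close>,
      \<open>v - u\<close> and \<open>v + u\<close> lies in \<open>D\<close>, so only one kind of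
      term in \<open>eq\<close> survives.\<close>
    consider "v \<in> D" "v - u \<notin> D" "v + u \<notin> D" | "v \<notin> D" "v - u \<notin> D" | "v \<notin> D" "v + u \<notin> D"
      using uB(1)[of v "v - u"] uB(1)[of "v + u" v] uB(2)[of "v + u" "v - u"] by auto
    then show ?thesis
      using eq none triv[of "v - u"] triv[of "v + u"] r[OF that] by cases auto
  qed
  moreover have "2 * diff_count Y Y (\<lambda>w. norm w = \<delta>) \<le> 2 ^ Suc L" if "\<delta> > 0" "\<delta> \<notin> F" for \<delta>
  \<comment> \<open>Either \<delta> is a new length, absent from \<open>X\<close> and produced by a
    unique \<open>v\<close>, or no mixed pair has length \<delta> and the old count merely doubles.
    The difference \<open>0\<close> never interferes, as it gives the length \<open>e L\<close> in
    \<open>F\<close>.\<close>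
  proof (cases "\<exists>v \<in> D - {0}. norm (v + u) = \<delta>")
    case True
    then obtain v where v: "v \<in> D - {0}" "norm (v + u) = \<delta>" by blast
    have "diff_count X X (\<lambda>w. norm w = \<delta>) = 0"
      using u(3)[OF v(1)] v(2) F'I by (intro diff_count_eq_0) metis
    moreover have "diff_count X X (\<lambda>w. norm (w + u) = \<delta>) \<le> diff_count X X (\<lambda>w. w = v)"
    proof (rule diff_count_mono)
      fix x y assume *: "x \<in> X" "y \<in> X" "norm (y - x + u) = \<delta>"
      then have "y - x \<noteq> 0" using u(1) that assms(3)[of L] by auto
      then show "y - x = v" using inj_onD[OF u(4), of "y - x" v] * v DI by auto
    qed (use X in auto)
    ultimately show ?thesis unfolding split sym using r[of v] v by simp
  next
    case False
    have "diff_count X X (\<lambda>w. norm (w + u) = \<delta>) = 0"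
    proof (rule diff_count_eq_0)
      fix x y assume *: "x \<in> X" "y \<in> X"
      then show "norm (y - x + u) \<noteq> \<delta>"
        using False u(1) that assms(3)[of L] DI[OF *] by (cases "y - x = 0") auto
    qed
    then show ?thesis unfolding split sym using off[OF that] by simp
  qed
  moreover have "card {j. j < Suc L \<and> e j = \<delta>} * 2 ^ Suc L \<le> diff_count Y Y (\<lambda>w. norm w = \<delta>)" for \<delta>
  proof (cases "e L = \<delta>")
    case True
    then have "{j. j < Suc L \<and> e j = \<delta>} = insert L {j. j < L \<and> e j = \<delta>}" by auto
    then have "card {j. j < Suc L \<and> e j = \<delta>} = Suc (card {j. j < L \<and> e j = \<delta>})" by simp
    \<comment> \<open>A point and its own translate differ by \<open>u\<close>; this gives
      \<open>2 ^ L\<close> pairs in each direction, which accounts for the additional index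
      \<open>L\<close>.\<close>
    moreover have "diff_count X X (\<lambda>w. w = 0) \<le> diff_count X X (\<lambda>w. norm (w + u) = \<delta>)"
      using u(1) True X by (intro diff_count_mono) auto
    ultimately show ?thesis unfolding split sym using on[of \<delta>] X
      by (simp add: diff_count_zero algebra_simps)
  next
    case False
    then have "{j. j < Suc L \<and> e j = \<delta>} = {j. j < L \<and> e j = \<delta>}" by (auto simp: less_Suc_eq)
    then show ?thesis unfolding split using on[of \<delta>] by simp
  qed
  moreover have "\<exists>x\<in>Y. \<exists>y\<in>Y. x \<noteq> y \<and> dist x y \<notin> F" if "Suc L \<ge> 2"
  proof -
    \<comment> \<open>For distinct \<open>x\<close> and \<open>y\<close> in \<open>X\<close>, the
      distance from \<open>x\<close> to the translate of \<open>y\<close> is generic, hence outside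
      \<open>F\<close>.\<close>
    have "card X \<ge> 2" using that X by (cases L) auto
    then obtain x y where xy: "x \<in> X" "y \<in> X" "x \<noteq> y"
      by (auto simp: numeral_2_eq_2 card_le_Suc_iff)
    then have "norm (y - x + u) \<notin> F" using u(3)[of "y - x"] DI by (auto simp: F'_def)
    then have "dist x (u + y) \<notin> F"
      by (simp add: dist_norm algebra_simps flip: norm_minus_cancel[of "x - _"])
    moreover have "x \<noteq> u + y" using disj xy by auto
    ultimately show ?thesis using xy unfolding Y_def by blast
  qed
  ultimately show ?case by blast
qed

section \<open>Adding points in general position\<close>

text \<open>The new point is \<open>x0 + u\<close> with \<open>u\<close> generic, so that its
  distances to \<open>X\<close> are pairwise distinct and do not occur in \<open>X\<close>. Each is
  then realised by one unordered pair, whence the 2 for ordered pairs.\<close>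

lemma insert_generic_point:
  fixes X :: "(real^2) set" and F :: "real set"
  assumes "finite X" "X \<noteq> {}" "finite F"
  obtains p where "p \<notin> X"
    "\<And>\<delta>. diff_count X X (\<lambda>w. norm w = \<delta>) \<le> diff_count (insert p X) (insert p X) (\<lambda>w. norm w = \<delta>)"
    "\<And>\<delta>. \<delta> > 0 \<Longrightarrow> \<delta> \<notin> F \<Longrightarrow> diff_count (insert p X) (insert p X) (\<lambda>w. norm w = \<delta>)
      \<le> max 2 (diff_count X X (\<lambda>w. norm w = \<delta>))"
proof -
  obtain x0 where x0: "x0 \<in> X" using assms by blast
  define F0 where "F0 = insert 0 (F \<union> (\<lambda>(x, y). norm (y - x)) ` (X \<times> X))"
  have F0I: "norm (y - x) \<in> F0" if "x \<in> X" "y \<in> X" for x y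
    using that by (force simp: F0_def)
  have "finite F0" using assms by (simp add: F0_def)
  \<comment> \<open>The distance from the new point to \<open>x0\<close> is \<open>R\<close> itself,
    so \<open>R\<close> has to avoid \<open>F0\<close>. Forbidding \<open>R\<close> for the
    remaining points keeps their distances different from it.\<close>
  then obtain R where R: "R > Max F0" "R > 0" by (meson gt_ex less_trans max_less_iff_conj)
  have RF: "R \<notin> F0" using R Max_ge[OF \<open>finite F0\<close>, of R] by auto
  define V where "V = (\<lambda>x. x0 - x) ` X - {0}"
  obtain u where u: "norm u = R" "u \<notin> {}" "\<And>v. v \<in> V \<Longrightarrow> norm (v + u) \<notin> insert R F0"
    "inj_on (\<lambda>v. norm (v + u)) V"
    using generic_vector_of_norm[of R V "insert R F0" "{}"] R assms \<open>finite F0\<close> by (auto simp: V_def)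
  define p where "p = x0 + u"
  have eq: "norm (x - p) = norm (x0 - x + u)" for x
    by (simp add: p_def norm_minus_commute algebra_simps)
  have avoid: "norm (x - p) \<notin> F0" if "x \<in> X" for x
    using u(1) u(3)[of "x0 - x"] RF that unfolding eq by (cases "x = x0") (auto simp: V_def)
  have inj: "x = y" if xy: "x \<in> X" "y \<in> X" "norm (x - p) = norm (y - p)" for x y
  proof -
    have eq': "norm (x0 - x + u) = norm (x0 - y + u)" using xy eq by simp
    have V: "x0 - z \<in> V" if "z \<in> X" "z \<noteq> x0" for z using that by (auto simp: V_def)
    show ?thesis
    proof (cases "x = x0 \<or> y = x0")
      case True
      then show ?thesis using u(1) u(3)[OF V[OF xy(1)]] u(3)[OF V[OF xy(2)]] eq' by fastforce
    next
      case False
      then show ?thesis using inj_onD[OF u(4) eq' V[OF xy(1)] V[OF xy(2)]] by simp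
    qed
  qed
  have pX: "p \<notin> X" using avoid[of p] by (auto simp: F0_def)
  have split: "diff_count (insert p X) (insert p X) (\<lambda>w. norm w = \<delta>) =
      diff_count X X (\<lambda>w. norm w = \<delta>) + 2 * diff_count {p} X (\<lambda>w. norm w = \<delta>)
      + diff_count {p} {p} (\<lambda>w. norm w = \<delta>)" for \<delta>
    using diff_count_insert[OF assms(1) pX, of "\<lambda>w. norm w = \<delta>"] by simp
  show thesis
  proof
    show "p \<notin> X" by fact
    show "diff_count X X (\<lambda>w. norm w = \<delta>) \<le> diff_count (insert p X) (insert p X) (\<lambda>w. norm w = \<delta>)" for \<delta>
      unfolding split by simp
    show "diff_count (insert p X) (insert p X) (\<lambda>w. norm w = \<delta>)
        \<le> max 2 (diff_count X X (\<lambda>w. norm w = \<delta>))" if "\<delta> > 0" "\<delta> \<notin> F" for \<delta>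
    proof -
      have pp: "diff_count {p} {p} (\<lambda>w. norm w = \<delta>) = 0"
        using that by (intro diff_count_eq_0) auto
      show ?thesis
      proof (cases "\<exists>x\<in>X. norm (x - p) = \<delta>")
        case True
        then obtain x where x: "x \<in> X" "norm (x - p) = \<delta>" by blast
        have "diff_count X X (\<lambda>w. norm w = \<delta>) = 0"
          using avoid[OF x(1)] x(2) F0I by (intro diff_count_eq_0) metis
        moreover have "{(a, b). a \<in> {p} \<and> b \<in> X \<and> norm (b - a) = \<delta>} = {(p, x)}"
          using x inj by auto
        then have "diff_count {p} X (\<lambda>w. norm w = \<delta>) = 1" unfolding diff_count_def by simp
        ultimately show ?thesis unfolding split pp by simp
      next
        case False
        then have "diff_count {p} X (\<lambda>w. norm w = \<delta>) = 0" by (intro diff_count_eq_0) auto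
        then show ?thesis unfolding split pp by simp
      qed
    qed
  qed
qed

text \<open>Iterating the insertion does not weaken the bound, because taking the maximum with 2 is
  idempotent.\<close>

lemma add_generic_points:
  fixes X :: "(real^2) set" and F :: "real set"
  assumes "finite X" "X \<noteq> {}" "finite F"
  shows "\<exists>Y. finite Y \<and> X \<subseteq> Y \<and> card Y = card X + m
    \<and> (\<forall>\<delta>. diff_count X X (\<lambda>w. norm w = \<delta>) \<le> diff_count Y Y (\<lambda>w. norm w = \<delta>))
    \<and> (\<forall>\<delta>. \<delta> > 0 \<longrightarrow> \<delta> \<notin> F \<longrightarrow>
          diff_count Y Y (\<lambda>w. norm w = \<delta>) \<le> max 2 (diff_count X X (\<lambda>w. norm w = \<delta>)))"
proof (induction m)
  case 0
  show ?case using assms by (intro exI[of _ X]) auto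
next
  case (Suc m)
  then obtain Y where Y: "finite Y" "X \<subseteq> Y" "card Y = card X + m"
    and lo: "\<And>\<delta>. diff_count X X (\<lambda>w. norm w = \<delta>) \<le> diff_count Y Y (\<lambda>w. norm w = \<delta>)"
    and hi: "\<And>\<delta>. \<delta> > 0 \<Longrightarrow> \<delta> \<notin> F \<Longrightarrow>
          diff_count Y Y (\<lambda>w. norm w = \<delta>) \<le> max 2 (diff_count X X (\<lambda>w. norm w = \<delta>))"
    by blast
  have "Y \<noteq> {}" using Y assms by auto
  then obtain p where p: "p \<notin> Y"
    "\<And>\<delta>. diff_count Y Y (\<lambda>w. norm w = \<delta>) \<le> diff_count (insert p Y) (insert p Y) (\<lambda>w. norm w = \<delta>)"
    "\<And>\<delta>. \<delta> > 0 \<Longrightarrow> \<delta> \<notin> F \<Longrightarrow> diff_count (insert p Y) (insert p Y) (\<lambda>w. norm w = \<delta>)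
      \<le> max 2 (diff_count Y Y (\<lambda>w. norm w = \<delta>))"
    using insert_generic_point[OF Y(1) _ assms(3)] by blast
  show ?case
  proof (intro exI[of _ "insert p Y"] conjI allI impI)
    fix \<delta> :: real
    show "diff_count X X (\<lambda>w. norm w = \<delta>) \<le> diff_count (insert p Y) (insert p Y) (\<lambda>w. norm w = \<delta>)"
      using lo p(2) le_trans by blast
    assume "\<delta> > 0" "\<delta> \<notin> F"
    then show "diff_count (insert p Y) (insert p Y) (\<lambda>w. norm w = \<delta>)
        \<le> max 2 (diff_count X X (\<lambda>w. norm w = \<delta>))"
      using hi[of \<delta>] p(3)[of \<delta>] by linarith
  qed (use Y p in auto)
qed

section \<open>Ranking the multiplicities\<close>

text \<open>As \<open>B < A\<close>, the sorted list of multiplicities is that of the complement of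
  \<open>T\<close> followed by that of \<open>T\<close>. After reversal, rank \<open>k\<close> is
  the least value on \<open>T\<close> and rank \<open>k + 1\<close> the greatest value off
  \<open>T\<close>.\<close>

lemma ranked_multiplicity_separated:
  assumes fin: "finite (distances X)" and T: "T \<subset> distances X" "card T = k" "k \<ge> 1"
    and A: "\<And>t. t \<in> T \<Longrightarrow> A \<le> multiplicity_at X t"
    and B: "\<And>t. t \<in> distances X - T \<Longrightarrow> multiplicity_at X t \<le> B"
    and "B < A"
  shows "ranked_multiplicity k X \<ge> A" "ranked_multiplicity (k + 1) X \<le> B" "top_distances k X = T"
proof -
  let ?f = "multiplicity_at X" and ?S = "distances X"
  have finT: "finite T" "finite (?S - T)" using fin T finite_subset by auto
  define l1 where "l1 = sorted_list_of_multiset (image_mset ?f (mset_set T))"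
  define l2 where "l2 = sorted_list_of_multiset (image_mset ?f (mset_set (?S - T)))"
  have set1: "set l1 = ?f ` T" and set2: "set l2 = ?f ` (?S - T)"
    using finT by (simp_all add: l1_def l2_def)
  have len1: "length l1 = k"
    using T finT by (simp add: l1_def flip: size_mset)
  have "?S - T \<noteq> {}" using T by blast
  then have ne2: "l2 \<noteq> []" using set2 by auto
  have s1: "sorted l1" and s2: "sorted l2" by (simp_all add: l1_def l2_def)
  have "sorted (l2 @ l1)"
    using s1 s2 set1 set2 A B \<open>B < A\<close> by (fastforce simp: sorted_append)
  moreover have "mset (l2 @ l1) = image_mset ?f (mset_set ?S)"
  proof -
    have "mset_set ?S = mset_set (?S - T) + mset_set T"
      using finT T by (subst mset_set_Union[symmetric]) (auto intro!: arg_cong[of _ _ mset_set])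
    then show ?thesis by (simp add: l1_def l2_def)
  qed
  ultimately have "multiplicities X = rev l1 @ rev l2"
    unfolding multiplicities_def
    by (metis rev_append sorted_list_of_multiset_mset sorted_sort_id)
  then have k: "ranked_multiplicity k X = l1 ! 0" and k1: "ranked_multiplicity (k + 1) X = rev l2 ! 0"
    using len1 \<open>k \<ge> 1\<close> by (simp_all add: ranked_multiplicity_def nth_append rev_nth)
  have "l1 ! 0 \<in> set l1" using len1 \<open>k \<ge> 1\<close> by (intro nth_mem) simp
  then show A': "ranked_multiplicity k X \<ge> A" using k set1 A by auto
  have "rev l2 ! 0 \<in> set (rev l2)" using ne2 by (intro nth_mem) simp
  then show "ranked_multiplicity (k + 1) X \<le> B" unfolding k1 using set2 B by auto
  have "l1 ! 0 \<le> ?f t" if "t \<in> T" for t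
  proof -
    have "?f t \<in> set l1" using that set1 by simp
    then show ?thesis using s1 by (metis in_set_conv_nth sorted_nth_mono zero_le)
  qed
  moreover have "\<not> ?f t \<ge> l1 ! 0" if "t \<in> ?S - T" for t
    using B[OF that] A' k \<open>B < A\<close> by simp
  ultimately show "top_distances k X = T"
    unfolding top_distances_def k using T by auto
qed

section \<open>Choice of parameters and the final estimate\<close>

text \<open>The numbers \<open>q * k + i\<close> with \<open>q < L div k\<close> are all in the
  class. This bounds below how often each prescribed length is used when lengths are assigned
  cyclically.\<close>

lemma card_residue_class_ge:
  assumes "i < k"
  shows "L div k \<le> card {j::nat. j < L \<and> j mod k = i}"
proof -
  have "inj_on (\<lambda>q. q * k + i) {..<L div k}" using assms by (auto simp: inj_on_def)
  moreover have "(\<lambda>q. q * k + i) ` {..<L div k} \<subseteq> {j. j < L \<and> j mod k = i}"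
  proof safe
    fix q assume "q < L div k"
    then have "(q + 1) * k \<le> L div k * k" by (intro mult_le_mono1) simp
    also have "\<dots> \<le> L" by simp
    finally show "q * k + i < L" using assms by simp
  qed (use assms in simp)
  ultimately show ?thesis
    using card_inj_on_le[of _ "{..<L div k}" "{j. j < L \<and> j mod k = i}"] by simp
qed

text \<open>With \<open>q = L div k\<close> and \<open>h\<close> a quarter of \<open>2 ^ L\<close>,
  prescribed distances have multiplicity at least \<open>2 * q * h\<close> and all others at most
  \<open>h\<close>. The constant 1/32 combines \<open>n \<le> 8 * h\<close> with
  \<open>log 2 n / k \<le> 4 * q\<close>.\<close>

lemma prescribed_top_distances:
  fixes d :: "nat \<Rightarrow> real"
  assumes n: "n \<ge> 4" and k: "1 \<le> k" "real k \<le> log 2 (real n)"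
    and d: "inj_on d {1..k}" "\<forall>i\<in>{1..k}. d i > 0"
  shows "\<exists>X :: (real ^ 2) set. finite X \<and> card X = n \<and> k + 1 \<le> card (distances X) \<and>
              real (ranked_multiplicity k X) - real (ranked_multiplicity (k + 1) X)
                \<ge> 1/32 * (real n / real k) * log 2 (real n) \<and>
              top_distances k X = d ` {1..k}"
proof -
  define L where "L = nat \<lfloor>log 2 (real n)\<rfloor>"
  have log2: "log 2 (real n) \<ge> 2" using n by (simp add: le_log_iff)
  have L: "real L \<le> log 2 (real n)" "log 2 (real n) < real L + 1" "L \<ge> 2"
    using log2 unfolding L_def by linarith+
  have kL: "k \<le> L" using k unfolding L_def by linarith
  have "2 powr real L \<le> real n" using L n by (simp add: le_log_iff)
  then have Ln: "2 ^ L \<le> n" by (simp add: powr_realpow)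
  have "real n < 2 powr (real L + 1)" using L n by (simp add: log_less_iff)
  then have nL: "real n < 2 * 2 ^ L" by (simp add: powr_add powr_realpow)
  define F where "F = d ` {1..k}"
  \<comment> \<open>The lengths are assigned cyclically; the shift by 1 is due to \<open>d\<close>
    being indexed from 1.\<close>
  define e where "e j = d (j mod k + 1)" for j
  have ind: "j mod k + 1 \<in> {1..k}" for j using k by (simp add: Suc_leI)
  have e: "e j > 0" "e j \<in> F" for j using ind[of j] d by (auto simp: e_def F_def)
  obtain C :: "(real^2) set" where C: "finite C" "card C = 2 ^ L"
    and off: "\<And>\<delta>. \<delta> > 0 \<Longrightarrow> \<delta> \<notin> F \<Longrightarrow> 2 * diff_count C C (\<lambda>w. norm w = \<delta>) \<le> 2 ^ L"
    and on: "\<And>\<delta>. card {j. j < L \<and> e j = \<delta>} * 2 ^ L \<le> diff_count C C (\<lambda>w. norm w = \<delta>)"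
    and extra: "\<exists>x\<in>C. \<exists>y\<in>C. x \<noteq> y \<and> dist x y \<notin> F"
    using generic_hypercube[of F e L] e \<open>L \<ge> 2\<close> by (auto simp: F_def)
  have "C \<noteq> {}" using C by auto
  then obtain X where X: "finite X" "C \<subseteq> X" "card X = 2 ^ L + (n - 2 ^ L)"
    and lo: "\<And>\<delta>. diff_count C C (\<lambda>w. norm w = \<delta>) \<le> diff_count X X (\<lambda>w. norm w = \<delta>)"
    and hi: "\<And>\<delta>. \<delta> > 0 \<Longrightarrow> \<delta> \<notin> F \<Longrightarrow>
          diff_count X X (\<lambda>w. norm w = \<delta>) \<le> max 2 (diff_count C C (\<lambda>w. norm w = \<delta>))"
    using add_generic_points[OF C(1), of F "n - 2 ^ L"] C by (auto simp: F_def)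
  have cardX: "card X = n" using X Ln by simp
  have "distances X = (\<lambda>(x, y). dist x y) ` {(x, y). x \<in> X \<and> y \<in> X \<and> x \<noteq> y}"
    by (auto simp: distances_def)
  moreover have "finite {(x, y). x \<in> X \<and> y \<in> X \<and> x \<noteq> y}"
    by (rule finite_subset[of _ "X \<times> X"]) (use X in auto)
  ultimately have finD: "finite (distances X)" by simp
  obtain h where h: "(2::nat) ^ L = 4 * h" "h \<ge> 1"
  proof
    show "(2::nat) ^ L = 4 * 2 ^ (L - 2)"
      using \<open>L \<ge> 2\<close> by (subst le_add_diff_inverse[of 2 L, symmetric], simp_all only: power_add, simp)
  qed simp
  have above: "L div k * (2 * h) \<le> multiplicity_at X \<delta>" if "\<delta> \<in> F" for \<delta>
  proof -
    obtain i where i: "i \<in> {1..k}" "\<delta> = d i" using \<open>\<delta> \<in> F\<close> by (auto simp: F_def)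
    have "L div k \<le> card {j. j < L \<and> j mod k = i - 1}"
      using i by (intro card_residue_class_ge) auto
    also have "\<dots> \<le> card {j. j < L \<and> e j = \<delta>}"
      using i by (intro card_mono) (auto simp: e_def)
    finally have "L div k * 2 ^ L \<le> card {j. j < L \<and> e j = \<delta>} * 2 ^ L" by simp
    also have "\<dots> \<le> diff_count X X (\<lambda>w. norm w = \<delta>)" using on lo le_trans by blast
    also have "\<dots> = 2 * multiplicity_at X \<delta>" using i d X by (simp add: two_multiplicity_at)
    finally show ?thesis unfolding h(1) by (simp add: mult_ac)
  qed
  \<comment> \<open>Since \<open>h \<ge> 1\<close>, the bound also covers the distances of
    multiplicity one created by the added points.\<close>
  have below: "multiplicity_at X \<delta> \<le> h" if "\<delta> > 0" "\<delta> \<notin> F" for \<delta>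
    using off[OF that] hi[OF that] two_multiplicity_at[OF X(1) that(1)] h by simp
  have q: "L div k \<ge> 1" using kL k by (simp add: Suc_leI div_greater_zero_iff)
  have "F \<subseteq> distances X"
  proof
    fix \<delta> assume "\<delta> \<in> F"
    have "1 * (2 * h) \<le> L div k * (2 * h)" using q by (intro mult_le_mono1)
    then have "multiplicity_at X \<delta> \<noteq> 0" using above[OF \<open>\<delta> \<in> F\<close>] h by linarith
    then show "\<delta> \<in> distances X"
      unfolding multiplicity_at_def distances_def by (auto simp: card_eq_0_iff)
  qed
  moreover obtain \<delta>0 where \<delta>0: "\<delta>0 \<in> distances X" "\<delta>0 \<notin> F"
    using extra X(2) unfolding distances_def by blast
  ultimately have psub: "F \<subset> distances X" by blast
  have cardF: "card F = k" using d by (simp add: F_def card_image)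
  have below': "multiplicity_at X \<delta> \<le> h" if "\<delta> \<in> distances X - F" for \<delta>
    using that by (intro below) (auto simp: distances_def)
  have "1 * h < L div k * (2 * h)" using q h by (intro le_less_trans[OF mult_le_mono1[OF q]]) simp
  then have hlt: "h < L div k * (2 * h)" by simp
  note rank = ranked_multiplicity_separated[OF finD psub cardF k(1) above below' hlt]
  have "card F < card (distances X)" using psub finD by (rule psubset_card_mono[rotated])
  then have "k + 1 \<le> card (distances X)" using cardF by simp
  moreover have "real (ranked_multiplicity k X) - real (ranked_multiplicity (k + 1) X)
                \<ge> 1/32 * (real n / real k) * log 2 (real n)"
  proof -
    \<comment> \<open>Rounding down costs at most a factor 2, as \<open>L div k \<ge> 1\<close>;
      replacing \<open>log 2 n\<close> by \<open>L\<close> costs another.\<close>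
    have "L < (L div k + 1) * k" using k by (simp add: dividend_less_div_times)
    also have "\<dots> \<le> (2 * (L div k)) * k" using q by (intro mult_le_mono1) simp
    finally have "real L < real (2 * (L div k) * k)" by (simp only: of_nat_less_iff)
    moreover have "log 2 (real n) \<le> 2 * real L" using L by linarith
    ultimately have lg: "log 2 (real n) / real k \<le> 4 * real (L div k)"
      using k by (simp add: field_simps)
    have "real n < 2 * real (2 ^ L)" using nL by simp
    then have nh: "real n \<le> 8 * real h" unfolding h by simp
    have "1/32 * (real n / real k) * log 2 (real n) = 1/32 * (real n * (log 2 (real n) / real k))"
      by simp
    also have "\<dots> \<le> 1/32 * ((8 * real h) * (4 * real (L div k)))"
      using lg nh log2 by (intro mult_left_mono mult_mono) auto
    also have "\<dots> = real (L div k) * real h" by simp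
    also have "\<dots> \<le> real (L div k) * (2 * real h) - real h"
      \<comment> \<open>As \<open>L div k \<ge> 1\<close>, subtracting \<open>h\<close> removes at
        most half of the main term.\<close>
      using mult_left_mono[of 1 "real (L div k)" "real h"] q by simp
    also have "\<dots> = real (L div k * (2 * h)) - real h" by simp
    also have "\<dots> \<le> real (ranked_multiplicity k X) - real (ranked_multiplicity (k + 1) X)"
      using rank(1,2) by (intro diff_mono) (simp_all only: of_nat_le_iff)
    finally show ?thesis .
  qed
  ultimately show ?thesis using X(1) cardX rank(3) unfolding F_def by blast
qed

theorem theorem1p9:
  "\<exists>(c::real) (n0::nat). c > 0 \<and>
     (\<forall>(n::nat) (k::nat). n \<ge> n0 \<longrightarrow> 1 \<le> k \<longrightarrow> real k \<le> log 2 (real n) \<longrightarrow>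
        (\<exists>X :: (real ^ 2) set. finite X \<and> card X = n \<and> k + 1 \<le> card (distances X) \<and>
           real (ranked_multiplicity k X) - real (ranked_multiplicity (k + 1) X)
             \<ge> c * (real n / real k) * log 2 (real n)) \<and>
        (\<forall>d :: nat \<Rightarrow> real. inj_on d {1..k} \<longrightarrow> (\<forall>i\<in>{1..k}. d i > 0) \<longrightarrow>
           (\<exists>X :: (real ^ 2) set. finite X \<and> card X = n \<and> k + 1 \<le> card (distances X) \<and>
              real (ranked_multiplicity k X) - real (ranked_multiplicity (k + 1) X)
                \<ge> c * (real n / real k) * log 2 (real n) \<and>
              top_distances k X = d ` {1..k})))"
proof (rule exI[of _ "1/32"], rule exI[of _ 4], intro conjI allI impI)
  fix n k :: nat
  assume nk: "4 \<le> n" "1 \<le> k" "real k \<le> log 2 (real n)"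
  \<comment> \<open>Without prescribed distances, the lengths 1 to \<open>k\<close> serve as well as
    any.\<close>
  have "inj_on real {1..k}" "\<forall>i\<in>{1..k}. real i > 0" by (auto simp: inj_on_def)
  from prescribed_top_distances[OF nk this]
  show "\<exists>X :: (real ^ 2) set. finite X \<and> card X = n \<and> k + 1 \<le> card (distances X) \<and>
           real (ranked_multiplicity k X) - real (ranked_multiplicity (k + 1) X)
             \<ge> 1/32 * (real n / real k) * log 2 (real n)"
    by blast
qed (use prescribed_top_distances in simp_all)

end
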